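(* Let $n\ge 1$. Let $\{\phi_j\}_{j\in\mathbb{N}}$ be an orthonormal sequence in $\ell^2(\mathbb{Z}^n)$ and let $g\in\ell^2(\mathbb{Z}^n)$ be a non-zero window function with $\|g\|_{\ell^2(\mathbb{Z}^n)}=1$. Then for any measurable $\Sigma\subset\mathbb{Z}^n\times\mathbb{T}^n$ of finite measure $(\nu\otimes\mu)(\Sigma)<\infty$ and every $N\in\mathbb{N}$, $$\sum_{j=1}^{N}\left(1-\left\|\chi_{\Sigma^{c}}V_g\phi_j\right\|_{L^2(\mathbb{Z}^n\times\mathbb{T}^n)}\right)\le(\nu\otimes\mu)(\Sigma).$$
   Context: For $f,g\in\ell^2(\mathbb{Z}^n)$ the short-time Fourier transform (STFT) of $f$ with window $g$ is the function on $\mathbb{Z}^n\times\mathbb{T}^n$ (where $\mathbb{T}^n=\mathbb{R}^n/\mathbb{Z}^n$) given by $V_gf(m,w)=\sum_{k\in\mathbb{Z}^n}f(k)\,\overline{g(k-m)}\,e^{-2\pi i w\cdot k}$. The measure $\nu\otimes\mu$ on $\mathbb{Z}^n\times\mathbb{T}^n$ is the product of the counting measure $\nu$ on $\mathbb{Z}^n$ and the Lebesgue measure $\mu$ on $\mathbb{T}^n$ (total mass $1$); $L^2(\mathbb{Z}^n\times\mathbb{T}^n)$ is taken with respect to $\nu\otimes\mu$. $\chi_A$ is the characteristic function of $A$ and $\Sigma^c$ is the complement of $\Sigma$ in $\mathbb{Z}^n\times\mathbb{T}^n$. *)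

theory Defs
  imports "HOL-Analysis.Analysis"
begin

definition int_cong :: "real^'n \<Rightarrow> real^'n \<Rightarrow> bool" where
  "int_cong x y \<longleftrightarrow> (\<forall>i. x $ i - y $ i \<in> \<int>)"

lemma equivp_int_cong: "equivp int_cong"
proof (rule equivpI)
  show "reflp int_cong"
    by (simp add: reflp_def int_cong_def)
  show "symp int_cong"
    unfolding symp_def int_cong_def by (metis Ints_minus minus_diff_eq)
  show "transp int_cong"
    unfolding transp_def int_cong_def by (metis Ints_add diff_add_cancel add_diff_eq)
qed

text \<open>The torus \<open>\<real>\<^sup>n / \<int>\<^sup>n\<close>, with \<open>n = CARD('n)\<close>; its quotient map is \<open>abs_torus\<close>.\<close>

quotient_type (overloaded) 'n torus = "real^('n::finite)" / int_cong
  by (rule equivp_int_cong)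

text \<open>A subset of the torus is measurable iff its preimage in \<open>\<real>\<^sup>n\<close> is Lebesgue measurable;
  its measure is that of the part of the preimage in the fundamental domain \<open>[0,1)\<^sup>n\<close>.\<close>

definition torus_measure :: "('n::finite) torus measure" where
  "torus_measure =
     distr (lebesgue_on {x :: real^'n. \<forall>i. 0 \<le> x $ i \<and> x $ i < 1})
           (sigma UNIV {A. abs_torus -` A \<in> sets lebesgue}) abs_torus"

lift_definition torus_char :: "int^'n \<Rightarrow> ('n::finite) torus \<Rightarrow> complex" is
  "\<lambda>k x. exp (- 2 * of_real pi * \<i> * of_real (x \<bullet> (\<chi> i. of_int (k $ i))))"
proof -
  fix k :: "int^'n" and x y :: "real^'n"
  assume "int_cong x y"
  let ?k = "\<chi> i. real_of_int (k $ i)"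
  have "(x - y) \<bullet> ?k \<in> \<int>"
    using \<open>int_cong x y\<close> unfolding int_cong_def inner_vec_def
    by (auto intro!: Ints_sum Ints_mult)
  then obtain m where "(x - y) \<bullet> ?k = of_int m"
    by (auto elim: Ints_cases)
  then have m: "x \<bullet> ?k = y \<bullet> ?k + of_int m"
    by (simp add: inner_diff_left)
  show "exp (- 2 * of_real pi * \<i> * of_real (x \<bullet> ?k)) =
        exp (- 2 * of_real pi * \<i> * of_real (y \<bullet> ?k))"
    unfolding m exp_eq by (rule exI[of _ "- m"]) (simp add: algebra_simps)
qed

definition ell2 :: "('a \<Rightarrow> complex) set" where
  "ell2 = {f. (\<lambda>k. (norm (f k))\<^sup>2) summable_on UNIV}"

definition ell2_inner :: "('a \<Rightarrow> complex) \<Rightarrow> ('a \<Rightarrow> complex) \<Rightarrow> complex" where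
  "ell2_inner f g = (\<Sum>\<^sub>\<infinity>k. f k * cnj (g k))"

definition ell2_norm :: "('a \<Rightarrow> complex) \<Rightarrow> real" where
  "ell2_norm f = sqrt (\<Sum>\<^sub>\<infinity>k. (norm (f k))\<^sup>2)"

definition ell2_orthonormal :: "'i set \<Rightarrow> ('i \<Rightarrow> 'a \<Rightarrow> complex) \<Rightarrow> bool" where
  "ell2_orthonormal I \<phi> \<longleftrightarrow>
     (\<forall>i\<in>I. \<phi> i \<in> ell2) \<and>
     (\<forall>i\<in>I. \<forall>j\<in>I. ell2_inner (\<phi> i) (\<phi> j) = (if i = j then 1 else 0))"

definition stft ::
  "(int^'n \<Rightarrow> complex) \<Rightarrow> (int^'n \<Rightarrow> complex) \<Rightarrow> (int^'n) \<times> ('n::finite) torus \<Rightarrow> complex"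
  where
  "stft g f = (\<lambda>(m, w). \<Sum>\<^sub>\<infinity>k. f k * cnj (g (k - m)) * torus_char k w)"

definition phase_measure :: "((int^'n) \<times> ('n::finite) torus) measure" where
  "phase_measure = count_space UNIV \<Otimes>\<^sub>M torus_measure"

text \<open>As usual for the Bochner integral, this is a norm only on square-integrable functions.\<close>

definition L2_norm :: "'a measure \<Rightarrow> ('a \<Rightarrow> complex) \<Rightarrow> real" where
  "L2_norm M F = sqrt (LINT p|M. (norm (F p))\<^sup>2)"

end

theory Submission
  imports Defs
begin

text \<open>Write \<open>b\<^sub>j\<close> for the part of the energy of \<open>V\<^sub>g \<phi>\<^sub>j\<close> lying in \<open>\<Sigma>\<close>. By Plancherel
  the part outside is \<open>1 - b\<^sub>j\<close>, and \<open>1 - sqrt (1 - b\<^sub>j) \<le> b\<^sub>j\<close> since \<open>0 \<le> b\<^sub>j \<le> 1\<close>. At each point of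
  phase space the values \<open>V\<^sub>g \<phi>\<^sub>j\<close> are the coefficients of a unit vector with respect to the
  orthonormal system, so by Bessel's inequality their squares add up to at most \<open>1\<close>; integrating
  over \<open>\<Sigma>\<close> bounds \<open>\<Sum> b\<^sub>j\<close> by the measure of \<open>\<Sigma>\<close>.\<close>

section \<open>Measurability and integration on the torus\<close>

text \<open>Preimages commute with complements and countable unions. Hence the \<open>sigma\<close>
  in \<open>torus_measure\<close> adds no sets to its generating family.\<close>

lemma sigma_algebra_torus:
  "sigma_algebra UNIV {A. (abs_torus :: real^'n::finite \<Rightarrow> 'n torus) -` A \<in> sets lebesgue}"
  unfolding sigma_algebra_iff2
proof (intro conjI ballI allI impI; clarsimp simp: vimage_Compl vimage_UN)
  fix A :: "'n torus set"
  assume "abs_torus -` A \<in> sets lebesgue"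
  then have "- (abs_torus -` A) \<in> sets lebesgue"
    by (metis Compl_in_sets_lebesgue)
  moreover have "abs_torus -` (UNIV - A) = - (abs_torus -` A)"
    by auto
  ultimately show "abs_torus -` (UNIV - A) \<in> sets lebesgue"
    by simp
qed auto

lemma sets_torus_measure:
  "sets torus_measure = {A. (abs_torus :: real^'n::finite \<Rightarrow> 'n torus) -` A \<in> sets lebesgue}"
  unfolding torus_measure_def sets_distr
  by (simp add: sigma_algebra.sigma_sets_eq[OF sigma_algebra_torus])

lemma space_torus_measure [simp]: "space torus_measure = UNIV"
  by (simp add: torus_measure_def)

lemma borel_measurable_torus_measureI:
  fixes f :: "'n::finite torus \<Rightarrow> 'b::topological_space"
  assumes "(\<lambda>x. f (abs_torus x)) \<in> borel_measurable lebesgue"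
  shows "f \<in> borel_measurable torus_measure"
proof (rule measurableI)
  fix B :: "'b set" assume "B \<in> sets borel"
  then have "(\<lambda>x. f (abs_torus x)) -` B \<inter> space lebesgue \<in> sets lebesgue"
    by (rule measurable_sets[OF assms])
  then show "f -` B \<inter> space torus_measure \<in> sets torus_measure"
    by (simp add: sets_torus_measure vimage_def)
qed simp

lemma sets_borel_unit_cube [measurable]:
  "{x :: real^'n. \<forall>i. 0 \<le> x $ i \<and> x $ i < 1} \<in> sets borel"
  by measurable

lemma measurable_abs_torus:
  "abs_torus \<in> lebesgue_on {x :: real^'n::finite. \<forall>i. 0 \<le> x $ i \<and> x $ i < 1} \<rightarrow>\<^sub>M
     sigma UNIV {A. abs_torus -` A \<in> sets lebesgue}"
proof (rule measurable_measure_of)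
  fix A :: "'n torus set" assume "A \<in> {A. abs_torus -` A \<in> sets lebesgue}"
  then show "abs_torus -` A \<inter> space (lebesgue_on {x. \<forall>i. 0 \<le> x $ i \<and> x $ i < 1})
      \<in> sets (lebesgue_on {x. \<forall>i. 0 \<le> x $ i \<and> x $ i < 1})"
    by (auto simp: sets_restrict_space space_restrict_space)
qed auto

text \<open>The lift is assumed Borel rather than Lebesgue measurable, so that the integral can be
  moved from the completion \<open>lebesgue\<close> to \<open>lborel\<close>, which has a product
  structure over the coordinates.\<close>

lemma integral_torus_measure:
  fixes f :: "'n::finite torus \<Rightarrow> 'b::{banach, second_countable_topology}"
  assumes f: "(\<lambda>x. f (abs_torus x)) \<in> borel_measurable borel"
  shows "integral\<^sup>L torus_measure f =
    (LINT x|lborel. indicator {x :: real^'n. \<forall>i. 0 \<le> x $ i \<and> x $ i < 1} x *\<^sub>R f (abs_torus x))"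
proof -
  let ?Q = "{x :: real^'n. \<forall>i. 0 \<le> x $ i \<and> x $ i < 1}"
  have "f \<in> borel_measurable torus_measure"
    using f by (intro borel_measurable_torus_measureI measurable_completion) simp
  then have *: "f \<in> borel_measurable (sigma UNIV {A. abs_torus -` A \<in> sets lebesgue})"
    by (simp add: torus_measure_def)
  have "integral\<^sup>L torus_measure f = (LINT x|lebesgue_on ?Q. f (abs_torus x))"
    unfolding torus_measure_def by (rule integral_distr[OF measurable_abs_torus *])
  also have "\<dots> = (LINT x|lebesgue. indicator ?Q x *\<^sub>R f (abs_torus x))"
    by (rule integral_restrict_space) simp
  also have "\<dots> = (LINT x|lborel. indicator ?Q x *\<^sub>R f (abs_torus x))"
    by (rule integral_completion) (use f in measurable)
  finally show ?thesis .
qed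

section \<open>Integrals of characters\<close>

text \<open>For nonzero \<open>n\<close> the antiderivative exp(c x) / c has period 1, so its
  boundary values cancel.\<close>

lemma integral_unit_interval_exp:
  "(LINT x|lborel. indicator {0..<1::real} x *\<^sub>R exp (- 2 * of_real pi * \<i> * of_real (x * of_int n)))
     = (if n = 0 then 1 else 0 :: complex)"
  (is "?L = _")
proof -
  let ?f = "\<lambda>x::real. exp (- 2 * of_real pi * \<i> * of_real (x * of_int n)) :: complex"
  \<comment> \<open>The endpoint 1 is a null set; adding it gives the compact interval on which the
    fundamental theorem of calculus is applied.\<close>
  have L: "?L = (LINT x|lborel. indicator {0..1::real} x *\<^sub>R ?f x)"
  proof (rule integral_cong_AE)
    show "AE x in lborel. indicator {0..<1::real} x *\<^sub>R ?f x = indicator {0..1::real} x *\<^sub>R ?f x"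
      using AE_lborel_singleton[of 1] by eventually_elim (auto simp: indicator_def)
  qed (auto intro!: borel_measurable_continuous_onI continuous_intros borel_measurable_scaleR)
  show ?thesis
  proof (cases "n = 0")
    case True
    then show ?thesis by (simp add: L)
  next
    case False
    define c where "c = - 2 * of_real pi * \<i> * of_int n"
    have c: "c \<noteq> 0" using False by (simp add: c_def)
    have f: "?f x = exp (c * of_real x)" for x by (simp add: c_def mult_ac)
    have "((\<lambda>x. exp (c * of_real x) / c) has_vector_derivative exp (c * of_real x)) (at x within {0..1})" for x :: real
      using c by (auto intro!: derivative_eq_intros has_vector_derivative_real_field)
    then have "(LINT x|lborel. indicator {0..1::real} x *\<^sub>R ?f x) = exp (c * of_real 1) / c - exp (c * of_real 0) / c"
      unfolding f by (intro integral_FTC_Icc) (auto intro!: continuous_intros)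
    also have "exp c = 1"
      unfolding c_def exp_eq_1 by (auto intro!: exI[of _ "- n"])
    then have "exp (c * of_real 1) / c - exp (c * of_real 0) / c = 0" by simp
    finally show ?thesis using False L by simp
  qed
qed

text \<open>On the unit cube the character is a product of one-variable exponentials. Fubini turns
  its integral into a product of one-dimensional integrals, and one factor vanishes as soon as some
  coordinate of \<open>k\<close> is nonzero.\<close>

lemma integral_torus_char:
  fixes k :: "int^'n::finite"
  shows "integral\<^sup>L torus_measure (torus_char k) = (if k = 0 then 1 else 0)"
proof -
  let ?Q = "{x :: real^'n. \<forall>i. 0 \<le> x $ i \<and> x $ i < 1}"
  let ?k = "\<chi> i. real_of_int (k $ i)"
  let ?e = "\<lambda>x::real^'n. exp (- 2 * of_real pi * \<i> * of_real (x \<bullet> ?k)) :: complex"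
  \<comment> \<open>The integer coordinate of \<open>k\<close> along the basis vector
    \<open>b\<close>; the floor is exact there. Indexing by \<open>Basis\<close> fits the
    description of \<open>lborel\<close> as the image of a product measure over
    \<open>Basis\<close>.\<close>
  let ?n = "\<lambda>b::real^'n. \<lfloor>?k \<bullet> b\<rfloor>"
  let ?h = "\<lambda>b t. indicator {0..<1::real} t *\<^sub>R exp (- 2 * of_real pi * \<i> * of_real (t * of_int (?n b))) :: complex"
  have n: "of_int (?n b) = ?k \<bullet> b" if "b \<in> Basis" for b
    using that by (auto simp: Basis_vec_def inner_axis)
  have e: "torus_char k (abs_torus x) = ?e x" for x
    by (simp add: torus_char.abs_eq)
  have meas: "?e \<in> borel_measurable borel"
    by (intro borel_measurable_continuous_onI continuous_intros)
  have prod: "indicator ?Q x *\<^sub>R ?e x = (\<Prod>b\<in>Basis. ?h b (x \<bullet> b))" for x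
  proof -
    have Q: "x \<in> ?Q \<longleftrightarrow> (\<forall>b\<in>Basis. x \<bullet> b \<in> {0..<1})"
      by (auto simp: Basis_vec_def inner_axis)
    have "x \<bullet> ?k = (\<Sum>b\<in>Basis. (x \<bullet> b) * of_int (?n b))"
      by (subst euclidean_inner) (simp add: n)
    then have "?e x = (\<Prod>b\<in>Basis. exp (- 2 * of_real pi * \<i> * of_real ((x \<bullet> b) * of_int (?n b))))"
      by (simp add: sum_distrib_left exp_sum flip: sum_negf)
    moreover have "(indicator ?Q x :: real) = (\<Prod>b\<in>Basis. indicator {0..<1} (x \<bullet> b))"
      using Q by (auto simp: indicator_def prod_zero_iff)
    ultimately show ?thesis
      by (simp add: scaleR_conv_of_real prod.distrib)
  qed
  interpret product_sigma_finite "\<lambda>_::real^'n. lborel :: real measure"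
    by standard
  have "integral\<^sup>L torus_measure (torus_char k) = (LINT x|lborel. (\<Prod>b\<in>Basis. ?h b (x \<bullet> b)))"
    by (subst integral_torus_measure) (simp_all only: e meas prod)
  also have "\<dots> = (LINT f|(\<Pi>\<^sub>M b\<in>(Basis :: (real^'n) set). lborel). (\<Prod>b\<in>Basis. ?h b ((\<Sum>b\<in>Basis. f b *\<^sub>R b) \<bullet> b)))"
  proof (subst lborel_eq, rule integral_distr)
    show "(\<lambda>x. \<Prod>b\<in>Basis. ?h b (x \<bullet> b)) \<in> borel_measurable borel"
      unfolding prod[symmetric] by (intro borel_measurable_scaleR meas) measurable
  qed simp
  also have "\<dots> = (LINT f|(\<Pi>\<^sub>M b\<in>(Basis :: (real^'n) set). lborel). (\<Prod>b\<in>Basis. ?h b (f b)))"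
    by (intro Bochner_Integration.integral_cong refl prod.cong) (simp add: inner_sum_left inner_Basis if_distrib cong: if_cong)
  also have "\<dots> = (\<Prod>b\<in>Basis. integral\<^sup>L lborel (?h b))"
  proof (rule product_integral_prod)
    fix b :: "real^'n"
    let ?g = "\<lambda>t::real. exp (- 2 * of_real pi * \<i> * of_real (t * of_int (?n b))) :: complex"
    have "integrable lborel (\<lambda>t. indicator {0..1::real} t *\<^sub>R ?g t)"
      by (intro borel_integrable_compact continuous_intros) auto
    then show "integrable lborel (?h b)"
    proof (rule Bochner_Integration.integrable_bound)
      show "?h b \<in> borel_measurable lborel"
        by (auto intro!: borel_measurable_continuous_onI continuous_intros borel_measurable_scaleR)
    qed (auto simp: indicator_def)
  qed simp
  also have "\<dots> = (\<Prod>b\<in>(Basis :: (real^'n) set). if ?n b = 0 then 1 else 0)"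
    unfolding integral_unit_interval_exp ..
  also have "\<dots> = (if k = 0 then 1 else 0)"
  proof (cases "k = 0")
    case False
    then obtain i where "k $ i \<noteq> 0" by (auto simp: vec_eq_iff)
    then have "?n (axis i 1) \<noteq> 0" by (simp add: inner_axis)
    then have "\<exists>b\<in>(Basis :: (real^'n) set). ?n b \<noteq> 0"
      by (intro bexI[of _ "axis i 1"]) (auto simp: Basis_vec_def)
    then show ?thesis using False by (auto simp: prod_zero_iff)
  next
    case True
    then have "?n b = 0" for b by (simp add: inner_vec_def)
    then show ?thesis using True by simp
  qed
  finally show ?thesis .
qed

lemma torus_char_0 [simp]: "torus_char 0 w = 1"
  by (transfer; simp add: inner_vec_def)

lemma norm_torus_char [simp]: "norm (torus_char k w) = 1"
  by transfer simp

text \<open>Turns the cross terms of a squared modulus into single characters, whose integrals are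
  known.\<close>

lemma torus_char_diff: "torus_char (k - l) w = torus_char k w * cnj (torus_char l w)"
proof transfer
  fix k l :: "int^'n" and x :: "real^'n"
  have eq: "x \<bullet> (\<chi> i. real_of_int ((k - l) $ i)) =
      x \<bullet> (\<chi> i. real_of_int (k $ i)) - x \<bullet> (\<chi> i. real_of_int (l $ i))"
    by (simp add: inner_vec_def right_diff_distrib sum_subtractf)
  show "exp (- 2 * of_real pi * \<i> * of_real (x \<bullet> (\<chi> i. real_of_int ((k - l) $ i)))) =
      exp (- 2 * of_real pi * \<i> * of_real (x \<bullet> (\<chi> i. real_of_int (k $ i)))) *
      cnj (exp (- 2 * of_real pi * \<i> * of_real (x \<bullet> (\<chi> i. real_of_int (l $ i)))))"
    unfolding eq by (simp add: exp_cnj algebra_simps flip: exp_add)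
qed

lemma borel_measurable_torus_char [measurable]: "torus_char k \<in> borel_measurable torus_measure"
  by (rule borel_measurable_torus_measureI, unfold torus_char.abs_eq)
     (auto intro!: measurable_completion borel_measurable_continuous_onI continuous_intros)


text \<open>The total mass is the integral of the trivial character.\<close>

lemma emeasure_torus_measure: "emeasure torus_measure (UNIV :: 'n::finite torus set) = 1"
proof -
  have "torus_char 0 = (\<lambda>_ :: 'n torus. 1)" by auto
  with integral_torus_char[of "0 :: int^'n"]
  have "measure torus_measure (UNIV :: 'n torus set) = 1"
    by (simp add: scaleR_conv_of_real)
  \<comment> \<open>\<open>measure\<close> sends infinite mass to 0, so the value 1 also shows that
    the mass is finite.\<close>
  then show ?thesis
    by (metis emeasure_eq_ennreal_measure ennreal_1 enn2real_top measure_def zero_neq_one)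
qed

interpretation torus: finite_measure "torus_measure :: 'n::finite torus measure"
  by (rule finite_measureI) (simp add: emeasure_torus_measure)

lemma integrable_torus_char [simp]: "integrable torus_measure (torus_char k)"
  by (rule torus.integrable_const_bound[where B = 1]) auto

section \<open>Plancherel for Fourier series on the torus\<close>

text \<open>Expanding the square as a product with the conjugate yields a double sum of characters
  of differences; orthogonality leaves only its diagonal.\<close>

lemma integral_trigonometric_polynomial:
  fixes h :: "int^'n::finite \<Rightarrow> complex"
  assumes "finite F"
  shows "(LINT w|torus_measure. (norm (\<Sum>k\<in>F. h k * torus_char k w))\<^sup>2) = (\<Sum>k\<in>F. (norm (h k))\<^sup>2)"
proof -
  have "of_real (LINT w|torus_measure. (norm (\<Sum>k\<in>F. h k * torus_char k w))\<^sup>2) =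
      (LINT w|torus_measure. of_real ((norm (\<Sum>k\<in>F. h k * torus_char k w))\<^sup>2) :: complex)"
    by (rule integral_complex_of_real[symmetric])
  also have "\<dots> = (LINT w|torus_measure. (\<Sum>k\<in>F. \<Sum>l\<in>F. h k * cnj (h l) * torus_char (k - l) w))"
    unfolding complex_norm_square by (simp add: sum_product torus_char_diff mult_ac)
  also have "\<dots> = (\<Sum>k\<in>F. \<Sum>l\<in>F. h k * cnj (h l) * (if k = l then 1 else 0))"
    by (simp add: integral_torus_char)
  also have "\<dots> = (\<Sum>k\<in>F. h k * cnj (h k))"
    using assms by (simp add: if_distrib cong: if_cong)
  also have "\<dots> = of_real (\<Sum>k\<in>F. (norm (h k))\<^sup>2)"
    by (simp only: complex_norm_square of_real_sum)
  finally show ?thesis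
    using of_real_eq_iff by blast
qed

text \<open>Sequential exhaustions, so that dominated convergence applies to unordered sums.\<close>

lemma finite_exhaustion:
  obtains F :: "nat \<Rightarrow> 'a::countable set"
  where "\<And>n. finite (F n)" and "filterlim F (finite_subsets_at_top UNIV) sequentially"
proof
  let ?F = "\<lambda>n. to_nat -` {..n} :: 'a set"
  show fin: "finite (?F n)" for n
    by (rule finite_vimageI) auto
  show "filterlim ?F (finite_subsets_at_top UNIV) sequentially"
    unfolding filterlim_finite_subsets_at_top
  proof (intro allI impI)
    fix X :: "'a set" assume "finite X \<and> X \<subseteq> UNIV"
    then have "\<forall>x\<in>X. to_nat x \<le> Max (to_nat ` X)" by auto
    then show "\<forall>\<^sub>F n in sequentially. finite (?F n) \<and> X \<subseteq> ?F n \<and> ?F n \<subseteq> UNIV"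
      unfolding eventually_sequentially using fin
      by (intro exI[of _ "Max (to_nat ` X)"]) (auto intro: order_trans)
  qed
qed

lemma summable_on_mult_torus_char:
  assumes "(\<lambda>k. norm (h k)) summable_on UNIV"
  shows "(\<lambda>k. h k * torus_char k w) summable_on UNIV"
  by (rule abs_summable_summable) (use assms in \<open>simp add: norm_mult\<close>)

text \<open>Bridge from unordered sums to integrals over counting measure, where Tonelli allows sums
  to be interchanged.\<close>

lemma nn_integral_count_space_conv_infsum:
  fixes f :: "'a \<Rightarrow> real"
  assumes "f summable_on A" and "\<And>x. x \<in> A \<Longrightarrow> 0 \<le> f x"
  shows "(\<integral>\<^sup>+x. f x \<partial>count_space A) = ennreal (infsum f A)"
proof -
  have "Infinite_Set_Sum.abs_summable_on f A"
    using assms(1) abs_summable_equivalent summable_on_iff_abs_summable_on_real by blast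
  then show ?thesis
    using assms(2) by (simp add: nn_integral_conv_infsetsum infsetsum_infsum)
qed

text \<open>Finite partial sums satisfy Parseval and are bounded uniformly by the sum
  \<open>?B\<close> of the norms of the coefficients. As the torus has finite mass, dominated
  convergence carries the identity to the limit. Absolute summability is the right setting for the
  STFT, whose coefficients are products of two square-summable functions.\<close>

lemma
  fixes h :: "int^'n::finite \<Rightarrow> complex"
  assumes h: "(\<lambda>k. norm (h k)) summable_on UNIV"
  shows borel_measurable_torus_series:
      "(\<lambda>w. \<Sum>\<^sub>\<infinity>k. h k * torus_char k w) \<in> borel_measurable torus_measure" (is "?V \<in> _")
    and nn_integral_torus_series:
      "(\<integral>\<^sup>+w. (norm (\<Sum>\<^sub>\<infinity>k. h k * torus_char k w))\<^sup>2 \<partial>torus_measure) =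
        (\<integral>\<^sup>+k. (norm (h k))\<^sup>2 \<partial>count_space UNIV)"
proof -
  obtain F :: "nat \<Rightarrow> (int^'n) set" where fin: "\<And>n. finite (F n)"
    and F: "filterlim F (finite_subsets_at_top UNIV) sequentially"
    by (rule finite_exhaustion) blast
  let ?S = "\<lambda>n w. \<Sum>k\<in>F n. h k * torus_char k w"
  let ?B = "\<Sum>\<^sub>\<infinity>k. norm (h k)"
  have lim: "(\<lambda>n. \<Sum>k\<in>F n. f k) \<longlonglongrightarrow> infsum f UNIV" if "f summable_on UNIV"
    for f :: "int^'n \<Rightarrow> 'b::real_normed_vector"
    using has_sum_infsum[OF that] F unfolding has_sum_def by (rule filterlim_compose)
  have limV: "(\<lambda>n. ?S n w) \<longlonglongrightarrow> ?V w" for w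
    by (rule lim[OF summable_on_mult_torus_char[OF h]])
  show meas: "?V \<in> borel_measurable torus_measure"
    by (rule borel_measurable_LIMSEQ_metric[OF _ limV]) measurable
  have bound: "norm (?S n w) \<le> ?B" for n w
  proof -
    have "norm (?S n w) \<le> (\<Sum>k\<in>F n. norm (h k))"
      by (rule sum_norm_le) (simp add: norm_mult)
    also have "\<dots> \<le> ?B"
      using h fin by (intro finite_sum_le_infsum) auto
    finally show ?thesis .
  qed
  have B: "norm (?V w) \<le> ?B" for w
    by (rule LIMSEQ_le_const2[OF tendsto_norm[OF limV]]) (use bound in auto)
  have 1: "(\<lambda>n. LINT w|torus_measure. (norm (?S n w))\<^sup>2) \<longlonglongrightarrow> (LINT w|torus_measure. (norm (?V w))\<^sup>2)"
  proof (rule integral_dominated_convergence[where w = "\<lambda>_. ?B\<^sup>2"])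
    show "(\<lambda>w. (norm (?V w))\<^sup>2) \<in> borel_measurable torus_measure"
      using meas by measurable
    show "AE w in torus_measure. (\<lambda>n. (norm (?S n w))\<^sup>2) \<longlonglongrightarrow> (norm (?V w))\<^sup>2"
      by (intro AE_I2 tendsto_intros limV)
    show "AE w in torus_measure. norm ((norm (?S n w))\<^sup>2) \<le> ?B\<^sup>2" for n
      using bound by (intro AE_I2) (simp add: power_mono)
  qed auto
  \<comment> \<open>Each single norm is at most the whole sum \<open>?B\<close>, so absolute
    summability implies square summability.\<close>
  have h2: "(\<lambda>k. (norm (h k))\<^sup>2) summable_on UNIV"
  proof (rule summable_on_comparison_test)
    show "(\<lambda>k. norm (h k) * ?B) summable_on UNIV"
      by (rule summable_on_cmult_left[OF h])
    show "(norm (h k))\<^sup>2 \<le> norm (h k) * ?B" for k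
      unfolding power2_eq_square
      using finite_sum_le_infsum[OF h, of "{k}"] by (intro mult_left_mono) auto
  qed simp
  have "(\<lambda>n. \<Sum>k\<in>F n. (norm (h k))\<^sup>2) \<longlonglongrightarrow> (\<Sum>\<^sub>\<infinity>k. (norm (h k))\<^sup>2)"
    by (rule lim[OF h2])
  with 1 have "(LINT w|torus_measure. (norm (?V w))\<^sup>2) = (\<Sum>\<^sub>\<infinity>k. (norm (h k))\<^sup>2)"
    unfolding integral_trigonometric_polynomial[OF fin] by (rule LIMSEQ_unique)
  moreover have "integrable torus_measure (\<lambda>w. (norm (?V w))\<^sup>2)"
    by (rule torus.integrable_const_bound[where B = "?B\<^sup>2"])
       (use B meas in \<open>auto simp: power_mono\<close>)
  ultimately have "(\<integral>\<^sup>+w. (norm (?V w))\<^sup>2 \<partial>torus_measure) = ennreal (\<Sum>\<^sub>\<infinity>k. (norm (h k))\<^sup>2)"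
    by (simp add: nn_integral_eq_integral)
  also have "\<dots> = (\<integral>\<^sup>+k. (norm (h k))\<^sup>2 \<partial>count_space UNIV)"
    by (rule nn_integral_count_space_conv_infsum[symmetric, OF h2]) simp
  finally show "(\<integral>\<^sup>+w. (norm (?V w))\<^sup>2 \<partial>torus_measure) =
      (\<integral>\<^sup>+k. (norm (h k))\<^sup>2 \<partial>count_space UNIV)" .
qed

section \<open>Inner products and Bessel's inequality in \<open>ell2\<close>\<close>

lemma summable_on_mult_ell2:
  assumes "f \<in> ell2" and "g \<in> ell2"
  shows "(\<lambda>k. norm (f k * g k)) summable_on UNIV"
proof (rule summable_on_comparison_test)
  show "(\<lambda>k. (norm (f k))\<^sup>2 + (norm (g k))\<^sup>2) summable_on UNIV"
    using assms by (intro summable_on_add) (auto simp: ell2_def)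
  show "norm (f k * g k) \<le> (norm (f k))\<^sup>2 + (norm (g k))\<^sup>2" for k
    using sum_squares_bound[of "norm (f k)" "norm (g k)"] mult_nonneg_nonneg[OF norm_ge_zero norm_ge_zero, of "f k" "g k"]
    unfolding norm_mult by linarith
qed simp

lemma has_sum_ell2_inner:
  assumes "f \<in> ell2" and "g \<in> ell2"
  shows "((\<lambda>k. f k * cnj (g k)) has_sum ell2_inner f g) UNIV"
proof -
  have "(\<lambda>k. cnj (g k)) \<in> ell2"
    using assms(2) by (simp add: ell2_def)
  then have "(\<lambda>k. f k * cnj (g k)) summable_on UNIV"
    by (rule abs_summable_summable[OF summable_on_mult_ell2[OF assms(1)]])
  then show ?thesis
    unfolding ell2_inner_def by (rule has_sum_infsum)
qed

lemma has_sum_ell2_norm: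
  assumes "f \<in> ell2"
  shows "((\<lambda>k. (norm (f k))\<^sup>2) has_sum (ell2_norm f)\<^sup>2) UNIV"
  using assms by (simp add: ell2_def ell2_norm_def infsum_nonneg)

lemma has_sum_sum:
  fixes f :: "'i \<Rightarrow> 'a \<Rightarrow> 'b::topological_comm_monoid_add"
  assumes "\<And>i. i \<in> I \<Longrightarrow> (f i has_sum s i) A"
  shows "((\<lambda>x. \<Sum>i\<in>I. f i x) has_sum (\<Sum>i\<in>I. s i)) A"
  using assms by (induction I rule: infinite_finite_induct) (auto intro: has_sum_add)

lemma has_sum_diff:
  fixes f g :: "'a \<Rightarrow> 'b::real_normed_vector"
  assumes "(f has_sum a) A" and "(g has_sum b) A"
  shows "((\<lambda>x. f x - g x) has_sum (a - b)) A"
  using has_sum_add[OF assms(1), of "\<lambda>x. - g x" "- b"] assms(2) by (simp add: has_sum_uminus)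

text \<open>Let \<open>v\<close> be the projection of \<open>h\<close> onto the span of the system.
  The inner products of \<open>h\<close> with \<open>v\<close>, of \<open>v\<close> with
  \<open>h\<close> and of \<open>v\<close> with itself all equal \<open>S\<close>, so the squared
  norm of \<open>h - v\<close> is that of \<open>h\<close> minus \<open>S\<close>, and it is
  nonnegative. Working with \<open>has_sum\<close> carries convergence along with the
  values.\<close>

lemma bessel_ell2:
  assumes "finite J" and \<phi>: "ell2_orthonormal J \<phi>" and h: "h \<in> ell2"
  shows "(\<Sum>j\<in>J. (norm (ell2_inner (\<phi> j) h))\<^sup>2) \<le> (ell2_norm h)\<^sup>2"
proof -
  define c where "c j = ell2_inner h (\<phi> j)" for j
  define v where "v k = (\<Sum>j\<in>J. c j * \<phi> j k)" for k
  define S where "S = (\<Sum>j\<in>J. c j * cnj (c j))"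
  have \<phi>2: "\<phi> j \<in> ell2" if "j \<in> J" for j
    using \<phi> that by (simp add: ell2_orthonormal_def)
  have "((\<lambda>k. \<Sum>j\<in>J. cnj (c j) * (h k * cnj (\<phi> j k))) has_sum (\<Sum>j\<in>J. cnj (c j) * c j)) UNIV"
    unfolding c_def by (intro has_sum_sum has_sum_cmult_right has_sum_ell2_inner h \<phi>2)
  then have hv: "((\<lambda>k. h k * cnj (v k)) has_sum S) UNIV"
    by (simp add: v_def S_def sum_distrib_left mult_ac)
  have "((\<lambda>k. cnj (h k * cnj (v k))) has_sum cnj S) UNIV"
    using hv by (simp only: has_sum_cnj_iff)
  then have vh: "((\<lambda>k. v k * cnj (h k)) has_sum S) UNIV"
    by (simp add: S_def mult_ac)
  have "((\<lambda>k. \<Sum>i\<in>J. \<Sum>j\<in>J. c i * cnj (c j) * (\<phi> i k * cnj (\<phi> j k))) has_sum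
      (\<Sum>i\<in>J. \<Sum>j\<in>J. c i * cnj (c j) * ell2_inner (\<phi> i) (\<phi> j))) UNIV"
    by (intro has_sum_sum has_sum_cmult_right has_sum_ell2_inner \<phi>2)
  moreover have "(\<Sum>i\<in>J. \<Sum>j\<in>J. c i * cnj (c j) * ell2_inner (\<phi> i) (\<phi> j)) = S"
  proof -
    have "c i * cnj (c j) * ell2_inner (\<phi> i) (\<phi> j) = (if i = j then c i * cnj (c i) else 0)"
      if "i \<in> J" "j \<in> J" for i j
      using \<phi> that by (simp add: ell2_orthonormal_def)
    then show ?thesis
      using \<open>finite J\<close> by (simp add: S_def)
  qed
  ultimately have vv: "((\<lambda>k. v k * cnj (v k)) has_sum S) UNIV"
    by (simp add: v_def sum_product mult_ac)
  have hh: "((\<lambda>k. h k * cnj (h k)) has_sum of_real ((ell2_norm h)\<^sup>2)) UNIV"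
    unfolding complex_norm_square[symmetric] by (rule has_sum_of_real[OF has_sum_ell2_norm[OF h]])
  have "((\<lambda>k. (h k - v k) * cnj (h k - v k)) has_sum (of_real ((ell2_norm h)\<^sup>2) - S) - (S - S)) UNIV"
    using has_sum_diff[OF has_sum_diff[OF hh hv] has_sum_diff[OF vh vv]] by (simp add: algebra_simps)
  then have "((\<lambda>k. Re ((h k - v k) * cnj (h k - v k))) has_sum (ell2_norm h)\<^sup>2 - Re S) UNIV"
    by (auto dest: has_sum_Re)
  then have "0 \<le> (ell2_norm h)\<^sup>2 - Re S"
    by (rule has_sum_nonneg) (simp only: complex_norm_square[symmetric] Re_complex_of_real zero_le_power2)
  \<comment> \<open>The coefficients \<open>c j\<close> have \<open>h\<close> in the first argument;
    exchanging the arguments conjugates the inner product and keeps its modulus.\<close>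
  moreover have "norm (ell2_inner (\<phi> j) h) = norm (c j)" for j
  proof -
    have "ell2_inner (\<phi> j) h = cnj (c j)"
      unfolding c_def ell2_inner_def infsum_cnj[symmetric] by (simp add: mult.commute)
    then show ?thesis by simp
  qed
  moreover have "S = of_real (\<Sum>j\<in>J. (norm (c j))\<^sup>2)"
    by (simp only: S_def complex_norm_square of_real_sum)
  ultimately show ?thesis by simp
qed

section \<open>Measurability and energy of the STFT\<close>

lemma ell2_translate:
  fixes g :: "'a::group_add \<Rightarrow> complex"
  assumes "g \<in> ell2"
  shows "(\<lambda>k. g (k - m)) \<in> ell2" and "ell2_norm (\<lambda>k. g (k - m)) = ell2_norm g"
proof -
  have bij: "bij_betw (\<lambda>k. k - m) UNIV UNIV"
    by (rule bij_betwI[where g = "\<lambda>k. k + m"]) auto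
  show "(\<lambda>k. g (k - m)) \<in> ell2"
    using assms summable_on_reindex_bij_betw[OF bij, of "\<lambda>k. (norm (g k))\<^sup>2"] by (simp add: ell2_def)
  show "ell2_norm (\<lambda>k. g (k - m)) = ell2_norm g"
    using infsum_reindex_bij_betw[OF bij, of "\<lambda>k. (norm (g k))\<^sup>2"] by (simp add: ell2_norm_def)
qed

lemma summable_on_stft:
  assumes "f \<in> ell2" and "g \<in> ell2"
  shows "(\<lambda>k. norm (f k * cnj (g (k - m)))) summable_on (UNIV :: (int^'n) set)"
  using summable_on_mult_ell2[OF assms(1) ell2_translate(1)[OF assms(2)]] by (simp add: norm_mult)

text \<open>The lattice is countable, so it suffices to treat each slice with \<open>m\<close>
  fixed, which is an absolutely convergent torus series.\<close>

lemma borel_measurable_stft [measurable]: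
  fixes f g :: "int^'n::finite \<Rightarrow> complex"
  assumes "f \<in> ell2" and "g \<in> ell2"
  shows "stft g f \<in> borel_measurable phase_measure"
  unfolding phase_measure_def stft_def
  by (rule measurable_pair_measure_countable1)
     (auto intro: borel_measurable_torus_series[OF summable_on_stft[OF assms]])

lemma nn_integral_ell2:
  assumes "f \<in> ell2"
  shows "(\<integral>\<^sup>+k. (norm (f k))\<^sup>2 \<partial>count_space UNIV) = ennreal ((ell2_norm f)\<^sup>2)"
  using assms by (simp add: ell2_def ell2_norm_def infsum_nonneg nn_integral_count_space_conv_infsum)

text \<open>For fixed \<open>m\<close> the STFT is the Fourier series with coefficients f(k) cnj(g(k
  - m)), so Plancherel removes the integral over the torus. Tonelli then exchanges \<open>m\<close>
  and \<open>k\<close>, and the sum over \<open>m\<close> gives the energy of \<open>g\<close> for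
  every \<open>k\<close>. Nonnegative integrals make the exchange possible before integrability is
  known.\<close>

lemma nn_integral_stft:
  fixes f g :: "int^'n::finite \<Rightarrow> complex"
  assumes f: "f \<in> ell2" and g: "g \<in> ell2"
  shows "(\<integral>\<^sup>+p. (norm (stft g f p))\<^sup>2 \<partial>phase_measure) = ennreal ((ell2_norm f)\<^sup>2 * (ell2_norm g)\<^sup>2)"
proof -
  note [measurable] = borel_measurable_stft[OF f g, unfolded phase_measure_def]
  have "(\<integral>\<^sup>+p. (norm (stft g f p))\<^sup>2 \<partial>phase_measure) =
      (\<integral>\<^sup>+m. \<integral>\<^sup>+w. (norm (stft g f (m, w)))\<^sup>2 \<partial>torus_measure \<partial>count_space UNIV)"
    unfolding phase_measure_def by (subst torus.nn_integral_fst[symmetric]) simp_all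
  also have "\<dots> = (\<integral>\<^sup>+m. \<integral>\<^sup>+k. (norm (f k * cnj (g (k - m))))\<^sup>2 \<partial>count_space UNIV \<partial>count_space UNIV)"
    unfolding stft_def prod.case by (simp only: nn_integral_torus_series[OF summable_on_stft[OF f g]])
  also have "\<dots> = (\<integral>\<^sup>+k. \<integral>\<^sup>+m. (norm (f k * cnj (g (k - m))))\<^sup>2 \<partial>count_space UNIV \<partial>count_space UNIV)"
    using nn_integral_fst_count_space[of "\<lambda>(m, k). ennreal ((norm (f k * cnj (g (k - m))))\<^sup>2)"]
      nn_integral_snd_count_space[of "\<lambda>(m, k). ennreal ((norm (f k * cnj (g (k - m))))\<^sup>2)"]
    by simp
  also have "\<dots> = (\<integral>\<^sup>+k. ennreal ((norm (f k))\<^sup>2) * ennreal ((ell2_norm g)\<^sup>2) \<partial>count_space UNIV)"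
  proof (rule nn_integral_cong)
    fix k :: "int^'n"
    \<comment> \<open>For fixed \<open>k\<close> this reflection is its own inverse.\<close>
    have bij: "bij_betw (\<lambda>m. k - m) UNIV UNIV"
      by (rule bij_betwI[where g = "\<lambda>m. k - m"]) simp_all
    have "(\<integral>\<^sup>+m. (norm (f k * cnj (g (k - m))))\<^sup>2 \<partial>count_space UNIV) =
        ennreal ((norm (f k))\<^sup>2) * (\<integral>\<^sup>+m. (norm (g (k - m)))\<^sup>2 \<partial>count_space UNIV)"
      by (simp add: norm_mult power_mult_distrib ennreal_mult nn_integral_cmult)
    also have "(\<integral>\<^sup>+m. (norm (g (k - m)))\<^sup>2 \<partial>count_space UNIV) = ennreal ((ell2_norm g)\<^sup>2)"
      using nn_integral_bij_count_space[OF bij, of "\<lambda>m. ennreal ((norm (g m))\<^sup>2)"] nn_integral_ell2[OF g]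
      by simp
    finally show "(\<integral>\<^sup>+m. (norm (f k * cnj (g (k - m))))\<^sup>2 \<partial>count_space UNIV) =
        ennreal ((norm (f k))\<^sup>2) * ennreal ((ell2_norm g)\<^sup>2)" .
  qed
  also have "\<dots> = ennreal ((ell2_norm f)\<^sup>2 * (ell2_norm g)\<^sup>2)"
    by (simp add: nn_integral_multc nn_integral_ell2[OF f] ennreal_mult)
  finally show ?thesis .
qed

lemma
  fixes f g :: "int^'n::finite \<Rightarrow> complex"
  assumes f: "f \<in> ell2" and g: "g \<in> ell2"
  shows integrable_stft: "integrable phase_measure (\<lambda>p. (norm (stft g f p))\<^sup>2)"
    and integral_stft: "(LINT p|phase_measure. (norm (stft g f p))\<^sup>2) = (ell2_norm f)\<^sup>2 * (ell2_norm g)\<^sup>2"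
proof -
  note [measurable] = borel_measurable_stft[OF f g]
  show "integrable phase_measure (\<lambda>p. (norm (stft g f p))\<^sup>2)"
    by (rule integrableI_nonneg) (simp_all add: nn_integral_stft[OF f g])
  show "(LINT p|phase_measure. (norm (stft g f p))\<^sup>2) = (ell2_norm f)\<^sup>2 * (ell2_norm g)\<^sup>2"
    by (subst integral_eq_nn_integral) (simp_all add: nn_integral_stft[OF f g])
qed

text \<open>The value of the transform at a point is the inner product with a time-frequency shift of the
  window, and such a shift preserves the norm.\<close>

lemma sum_stft_le:
  fixes g :: "int^'n::finite \<Rightarrow> complex"
  assumes "finite J" and \<phi>: "ell2_orthonormal J \<phi>" and g: "g \<in> ell2"
  shows "(\<Sum>j\<in>J. (norm (stft g (\<phi> j) p))\<^sup>2) \<le> (ell2_norm g)\<^sup>2"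
proof (cases p)
  case (Pair m w)
  \<comment> \<open>The character is conjugated because \<open>ell2_inner\<close> conjugates its
    second argument.\<close>
  let ?h = "\<lambda>k. g (k - m) * cnj (torus_char k w)"
  have norm_h: "norm (?h k) = norm (g (k - m))" for k
    by (simp add: norm_mult)
  have "?h \<in> ell2"
    using ell2_translate(1)[OF g, of m] unfolding ell2_def mem_Collect_eq norm_h .
  then have "(\<Sum>j\<in>J. (norm (ell2_inner (\<phi> j) ?h))\<^sup>2) \<le> (ell2_norm ?h)\<^sup>2"
    by (rule bessel_ell2[OF assms(1,2)])
  also have "ell2_norm ?h = ell2_norm g"
    using ell2_translate(2)[OF g, of m] unfolding ell2_norm_def norm_h .
  finally show ?thesis
    by (simp add: Pair stft_def ell2_inner_def mult.assoc)
qed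

section \<open>Concentration bound for orthonormal sequences\<close>

theorem theorem3p2:
  fixes \<phi> :: "nat \<Rightarrow> int^('n::finite) \<Rightarrow> complex"
    and g :: "int^'n \<Rightarrow> complex"
    and \<Sigma> :: "((int^'n) \<times> 'n torus) set"
    and N :: nat
  assumes "ell2_orthonormal {1..} \<phi>"
    and "g \<in> ell2" and "g \<noteq> (\<lambda>_. 0)" and "ell2_norm g = 1"
    and "\<Sigma> \<in> sets phase_measure" and "emeasure phase_measure \<Sigma> < \<infinity>"
  shows "(\<Sum>j=1..N. 1 - L2_norm phase_measure (\<lambda>p. indicator (- \<Sigma>) p * stft g (\<phi> j) p))
           \<le> measure phase_measure \<Sigma>"
proof -
  let ?V = "\<lambda>j p. (norm (stft g (\<phi> j) p))\<^sup>2"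
  define b where "b j = (LINT p|phase_measure. indicator \<Sigma> p * ?V j p)" for j
  have \<phi>: "\<phi> j \<in> ell2" and norm_\<phi>: "(ell2_norm (\<phi> j))\<^sup>2 = 1" if "j \<in> {1..N}" for j
  proof -
    show \<phi>: "\<phi> j \<in> ell2"
      using assms(1) that by (simp add: ell2_orthonormal_def)
    have "((\<lambda>k. \<phi> j k * cnj (\<phi> j k)) has_sum 1) UNIV"
      using has_sum_ell2_inner[OF \<phi> \<phi>] assms(1) that by (simp add: ell2_orthonormal_def)
    moreover have "((\<lambda>k. \<phi> j k * cnj (\<phi> j k)) has_sum of_real ((ell2_norm (\<phi> j))\<^sup>2)) UNIV"
      unfolding complex_norm_square[symmetric] by (rule has_sum_of_real[OF has_sum_ell2_norm[OF \<phi>]])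
    ultimately show "(ell2_norm (\<phi> j))\<^sup>2 = 1"
      using has_sum_unique of_real_eq_1_iff by metis
  qed
  have int\<Sigma>: "integrable phase_measure (\<lambda>p. indicator \<Sigma> p * ?V j p)" if "j \<in> {1..N}" for j
    using integrable_real_mult_indicator[OF assms(5) integrable_stft[OF \<phi>[OF that] assms(2)]]
    by (simp add: mult.commute)
  have le: "1 - L2_norm phase_measure (\<lambda>p. indicator (- \<Sigma>) p * stft g (\<phi> j) p) \<le> b j"
    if j: "j \<in> {1..N}" for j
  proof -
    \<comment> \<open>Pointwise, the energy off \<Sigma> is the total energy minus the energy on
      \<Sigma>; the total integrates to 1 because both norms are 1.\<close>
    have "(LINT p|phase_measure. (norm (indicator (- \<Sigma>) p * stft g (\<phi> j) p))\<^sup>2) =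
        (LINT p|phase_measure. ?V j p - indicator \<Sigma> p * ?V j p)"
      by (intro Bochner_Integration.integral_cong) (auto simp: indicator_def)
    also have "\<dots> = 1 - b j"
      unfolding b_def
      by (subst Bochner_Integration.integral_diff[OF integrable_stft[OF \<phi>[OF j] assms(2)] int\<Sigma>[OF j]])
         (simp add: integral_stft[OF \<phi>[OF j] assms(2)] norm_\<phi>[OF j] assms(4))
    finally have eq: "(LINT p|phase_measure. (norm (indicator (- \<Sigma>) p * stft g (\<phi> j) p))\<^sup>2) = 1 - b j" .
    \<comment> \<open>Nonnegative integrands give 0 <= \<open>b j\<close> <= 1, whence (1 -
      \<open>b j\<close>)^2 <= 1 - \<open>b j\<close>, and taking roots gives the required
      bound.\<close>
    moreover have "0 \<le> (LINT p|phase_measure. (norm (indicator (- \<Sigma>) p * stft g (\<phi> j) p))\<^sup>2)"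
      by simp
    moreover have "0 \<le> b j"
      unfolding b_def by (intro integral_nonneg_AE) auto
    ultimately have "1 - b j \<le> sqrt (1 - b j)"
      by (intro real_le_rsqrt) (simp add: power2_eq_square mult_left_le)
    with eq show ?thesis
      by (simp add: L2_norm_def)
  qed
  have ortho: "ell2_orthonormal {1..N} \<phi>"
    using assms(1) by (simp add: ell2_orthonormal_def)
  have "(\<Sum>j=1..N. 1 - L2_norm phase_measure (\<lambda>p. indicator (- \<Sigma>) p * stft g (\<phi> j) p)) \<le> (\<Sum>j=1..N. b j)"
    by (intro sum_mono le)
  also have "\<dots> = (LINT p|phase_measure. (\<Sum>j=1..N. indicator \<Sigma> p * ?V j p))"
    unfolding b_def by (rule Bochner_Integration.integral_sum[symmetric]) (rule int\<Sigma>)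
  also have "\<dots> \<le> (LINT p|phase_measure. indicator \<Sigma> p)"
  proof (rule integral_mono)
    show "(\<Sum>j=1..N. indicator \<Sigma> p * ?V j p) \<le> indicator \<Sigma> p" for p
      \<comment> \<open>On \<Sigma> this is the Bessel bound with a window of norm 1; off \<Sigma>
        both sides are 0.\<close>
      using sum_stft_le[OF _ ortho assms(2), of p] assms(4) by (auto simp: indicator_def)
    show "integrable phase_measure (\<lambda>p. \<Sum>j=1..N. indicator \<Sigma> p * ?V j p)"
      by (intro Bochner_Integration.integrable_sum int\<Sigma>)
  \<comment> \<open>The remaining goal, integrability of the indicator, is where the finite measure
    of \<Sigma> enters.\<close>
  qed (use assms(5,6) in simp)
  also have "\<dots> = measure phase_measure \<Sigma>"
    using sets.sets_into_space[OF assms(5)] by (simp add: Int_absorb2)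
  finally show ?thesis .
qed

end
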